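(* Let $\phi(x_1,\dots,x_n)$ be a formula of existential loose $[0,1]$-guarded real arithmetic with real constants, with free variables among $x_1,\dots,x_n$. Then the relation $\{(a_1,\dots,a_n)\in\mathbb R^n\mid(\mathbb R,+,\times,\le,(r)_{r\in\mathbb R})\models\phi(a_1,\dots,a_n)\}$ is closed in $\mathbb R^n$ (usual topology).
   Context: Formulae of existential loose $[0,1]$-guarded real arithmetic with real constants: $\phi::=i\le i\mid\phi\wedge\phi\mid\phi\vee\phi\mid\exists x\,(0\le x\wedge x\le1\wedge\phi)$, with terms $i::=0\mid1\mid r\mid x\mid i\times i\mid i+i$ where $r\in\mathbb R$ are constants and $x$ variables; semantics is the usual one over the reals. *)

theory Defs
  imports "HOL-Analysis.Analysis"
begin

datatype rterm =
    Zero
  | One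
  | Const real
  | Var nat
  | Times rterm rterm
  | Plus rterm rterm

text \<open>
  \<open>ExGuard x \<phi>\<close> encodes the formula \<open>\<exists>x (0 \<le> x \<and> x \<le> 1 \<and> \<phi>)\<close>: the guard is part of the
  constructor because the grammar admits quantifiers in this shape only.
\<close>
datatype formula =
    Le rterm rterm
  | And formula formula
  | Or formula formula
  | ExGuard nat formula

primrec term_vars :: "rterm \<Rightarrow> nat set" where
  "term_vars Zero = {}"
| "term_vars One = {}"
| "term_vars (Const r) = {}"
| "term_vars (Var x) = {x}"
| "term_vars (Times s t) = term_vars s \<union> term_vars t"
| "term_vars (Plus s t) = term_vars s \<union> term_vars t"

primrec free_vars :: "formula \<Rightarrow> nat set" where
  "free_vars (Le s t) = term_vars s \<union> term_vars t"
| "free_vars (And \<phi> \<psi>) = free_vars \<phi> \<union> free_vars \<psi>"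
| "free_vars (Or \<phi> \<psi>) = free_vars \<phi> \<union> free_vars \<psi>"
| "free_vars (ExGuard x \<phi>) = free_vars \<phi> - {x}"

primrec term_val :: "(nat \<Rightarrow> real) \<Rightarrow> rterm \<Rightarrow> real" where
  "term_val e Zero = 0"
| "term_val e One = 1"
| "term_val e (Const r) = r"
| "term_val e (Var x) = e x"
| "term_val e (Times s t) = term_val e s * term_val e t"
| "term_val e (Plus s t) = term_val e s + term_val e t"

primrec sat :: "(nat \<Rightarrow> real) \<Rightarrow> formula \<Rightarrow> bool" where
  "sat e (Le s t) \<longleftrightarrow> term_val e s \<le> term_val e t"
| "sat e (And \<phi> \<psi>) \<longleftrightarrow> sat e \<phi> \<and> sat e \<psi>"
| "sat e (Or \<phi> \<psi>) \<longleftrightarrow> sat e \<phi> \<or> sat e \<psi>"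
| "sat e (ExGuard x \<phi>) \<longleftrightarrow> (\<exists>r. 0 \<le> r \<and> r \<le> 1 \<and> sat (e(x := r)) \<phi>)"

lemma term_val_cong:
  "(\<And>v. v \<in> term_vars t \<Longrightarrow> e v = e' v) \<Longrightarrow> term_val e t = term_val e' t"
  by (induction t) auto

lemma sat_cong:
  "(\<And>v. v \<in> free_vars \<phi> \<Longrightarrow> e v = e' v) \<Longrightarrow> sat e \<phi> \<longleftrightarrow> sat e' \<phi>"
proof (induction \<phi> arbitrary: e e')
  case (Le s t)
  then show ?case using term_val_cong[of s e e'] term_val_cong[of t e e'] by simp
next
  case (And \<phi> \<psi>)
  then show ?case by (metis UnCI free_vars.simps(2) sat.simps(2))
next
  case (Or \<phi> \<psi>)
  then show ?case by (metis UnCI free_vars.simps(3) sat.simps(3))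
next
  case (ExGuard x \<phi>)
  have "sat (e(x := r)) \<phi> \<longleftrightarrow> sat (e'(x := r)) \<phi>" for r
    by (rule ExGuard.IH) (use ExGuard.prems in auto)
  then show ?case by simp
qed

text \<open>
  Truth of \<open>\<phi>(a\<^sub>0, \<dots>, a\<^sub>n\<^sub>-\<^sub>1)\<close>, the variable \<open>x i\<close> taking the value \<open>a i\<close> for \<open>i < n\<close>; the sequence
  \<open>x\<close> is meant to be injective on \<open>{..<n}\<close>. The values of the other variables are quantified
  away; by \<open>sat_cong\<close> they are irrelevant if the free variables of \<open>\<phi>\<close> are among the \<open>x i\<close>.
\<close>
definition models :: "nat \<Rightarrow> (nat \<Rightarrow> nat) \<Rightarrow> formula \<Rightarrow> (nat \<Rightarrow> real) \<Rightarrow> bool" where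
  "models n x \<phi> a \<longleftrightarrow> (\<forall>e. (\<forall>i<n. e (x i) = a i) \<longrightarrow> sat e \<phi>)"

text \<open>
  The library's \<open>Euclidean_space n\<close> is \<open>\<real>\<^sup>n\<close> for an arbitrary natural number \<open>n\<close> (including 0),
  its points being the functions \<open>nat \<Rightarrow> real\<close> that vanish at all \<open>i \<ge> n\<close>.
\<close>
definition defined_relation :: "nat \<Rightarrow> (nat \<Rightarrow> nat) \<Rightarrow> formula \<Rightarrow> (nat \<Rightarrow> real) set" where
  "defined_relation n x \<phi> = {a \<in> topspace (Euclidean_space n). models n x \<phi> a}"

end

theory Submission
  imports Defs
begin

text \<open>
  By induction on \<open>\<phi>\<close>, the set of satisfying assignments is closed in the product topology
  on \<open>nat \<Rightarrow> real\<close>. The only non-trivial case is the guarded quantifier, where the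
  compactness of \<open>[0,1]\<close> makes the projection along the quantified coordinate a closed map.
  The relation in question is a continuous preimage of this set.
\<close>

lemma continuous_on_term_val: "continuous_on UNIV (\<lambda>e. term_val e t)"
  by (induction t) (simp_all add: continuous_on_add continuous_on_mult)

text \<open>The set is the image of \<open>T \<inter> S \<times> UNIV\<close> under
  \<open>snd\<close>. Taking \<open>S\<close> itself as the first factor space makes that factor
  compact, so \<open>snd\<close> is a closed map.\<close>

lemma closed_bex_compact:
  fixes T :: "('a::topological_space \<times> 'b::topological_space) set"
  assumes "compact S" "closed T"
  shows "closed {y. \<exists>r\<in>S. (r, y) \<in> T}"
proof -
  let ?S = "top_of_set S"
  have "closedin (prod_topology ?S euclidean) (T \<inter> S \<times> UNIV)"
    using assms(2) by (auto simp: prod_topology_subtopology(1) closedin_closed Int_commute)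
  moreover have "closed_map (prod_topology ?S euclidean) (euclidean :: 'b topology) snd"
    using assms(1) by (intro Abstract_Topological_Spaces.closed_map_snd) (simp add: compact_space_subtopology)
  ultimately have "closed (snd ` (T \<inter> S \<times> UNIV))"
    by (simp add: closed_map_def)
  also have "snd ` (T \<inter> S \<times> UNIV) = {y. \<exists>r\<in>S. (r, y) \<in> T}"
    by force
  finally show ?thesis .
qed

text \<open>Coordinate \<open>x\<close> of the update is the first projection; any other coordinate
  is read off \<open>e\<close>. Joint continuity in \<open>r\<close> and \<open>e\<close> makes the
  body of a quantifier a closed condition on pairs.\<close>

lemma continuous_on_fun_upd:
  "continuous_on UNIV (\<lambda>(r, e). (e :: 'a \<Rightarrow> 'b::topological_space)(x := r))"
proof (rule continuous_on_coordinatewise_then_product)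
  fix v
  have "continuous_on UNIV (\<lambda>p :: 'b \<times> ('a \<Rightarrow> 'b). snd p v)"
    by (rule continuous_on_product_then_coordinatewise) (rule continuous_on_snd[OF continuous_on_id])
  then show "continuous_on UNIV (\<lambda>p. (case p of (r, e) \<Rightarrow> (e :: 'a \<Rightarrow> 'b)(x := r)) v)"
    by (cases "v = x") (simp_all add: case_prod_unfold continuous_on_fst)
qed

text \<open>Total assignments keep the ambient space fixed during the induction, although
  quantifiers change the free variables.\<close>

lemma closed_sat: "closed {e. sat e \<phi>}"
proof (induction \<phi>)
  case (Le s t)
  then show ?case
    by (simp add: closed_Collect_le continuous_on_term_val)
next
  case (And \<phi> \<psi>)
  then show ?case
    by (simp add: closed_Collect_conj)
next
  case (Or \<phi> \<psi>)
  then show ?case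
    by (simp add: closed_Collect_disj)
next
  case (ExGuard x \<phi>)
  have "closed ((\<lambda>(r, e). e(x := r)) -` {e. sat e \<phi>})"
    using ExGuard continuous_on_fun_upd by (rule closed_vimage)
  then have "closed {e. \<exists>r\<in>{0..1}. (r, e) \<in> (\<lambda>(r, e). e(x := r)) -` {e. sat e \<phi>}}"
    by (intro closed_bex_compact) auto
  then show ?case
    by (simp add: Bex_def)
qed

lemma models_iff_sat:
  assumes "inj_on x {..<n}" and "free_vars \<phi> \<subseteq> x ` {..<n}"
  shows "models n x \<phi> a \<longleftrightarrow> sat (\<lambda>v. a (inv_into {..<n} x v)) \<phi>"
proof -
  let ?e = "\<lambda>v. a (inv_into {..<n} x v)"
  have e: "\<forall>i<n. ?e (x i) = a i"
    using assms(1) by simp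
  have sat_e: "sat e \<phi> \<longleftrightarrow> sat ?e \<phi>" if "\<forall>i<n. e (x i) = a i" for e
  proof (rule sat_cong)
    fix v
    assume "v \<in> free_vars \<phi>"
    then obtain i where "i < n" "v = x i"
      using assms(2) by auto
    then show "e v = ?e v"
      using that assms(1) by simp
  qed
  show ?thesis
    unfolding models_def
  proof
    assume "\<forall>e. (\<forall>i<n. e (x i) = a i) \<longrightarrow> sat e \<phi>"
    from this[rule_format, of ?e] show "sat ?e \<phi>"
      using e by simp
  next
    assume "sat ?e \<phi>"
    then show "\<forall>e. (\<forall>i<n. e (x i) = a i) \<longrightarrow> sat e \<phi>"
      by (intro allI impI) (simp only: sat_e)
  qed
qed

theorem theorem4p5:
  fixes n :: nat and x :: "nat \<Rightarrow> nat" and \<phi> :: formula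
  assumes "inj_on x {..<n}"
    and "free_vars \<phi> \<subseteq> x ` {..<n}"
  shows "closedin (Euclidean_space n) (defined_relation n x \<phi>)"
proof -
  let ?f = "\<lambda>(a :: nat \<Rightarrow> real) v. a (inv_into {..<n} x v)"
  have "continuous_on UNIV ?f"
    \<comment> \<open>Each coordinate of \<open>?f\<close> evaluates \<open>a\<close> at a fixed
      index, whichever index \<open>inv_into\<close> yields.\<close>
    by (intro continuous_on_coordinatewise_then_product continuous_on_product_coordinates)
  then have "closed (?f -` {e. sat e \<phi>})"
    using closed_sat by (rule closed_vimage[rotated])
  moreover have "defined_relation n x \<phi> = topspace (Euclidean_space n) \<inter> ?f -` {e. sat e \<phi>}"
    unfolding defined_relation_def models_iff_sat[OF assms] by auto
  \<comment> \<open>\<open>Euclidean_space n\<close> carries the subspace topology of the full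
    product.\<close>
  ultimately show ?thesis
    by (simp add: Euclidean_space_def euclidean_product_topology closedin_subtopology_Int_closed)
qed

end
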